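(* Let $m,n$ be positive integers and let ${\sf w}\in[m]^n$. Then the action of ${\sf w}$ on $V^m$ has a fixed point if and only if ${\sf w}$ is an $(m,n)$-parking word. More precisely, the action of ${\sf w}$ on $V^m$: (i) has a unique fixed point if and only if ${\sf w}\in\mathcal{PW}_m^n$ and $\gcd(m,n)=1$; (ii) has infinitely many fixed points if and only if ${\sf w}\in\mathcal{PW}_m^n$ and $\gcd(m,n)>1$; (iii) has no fixed points if and only if ${\sf w}\in[m]^n\setminus\mathcal{PW}_m^n$.
   Context: $[m]=\{0,1,\ldots,m-1\}$. The set of $(m,n)$-parking words $\mathcal{PW}_m^n$ consists of the words ${\sf p}={\sf p}_0\cdots{\sf p}_{n-1}\in[m]^n$ such that $|\{j:{\sf p}_j<i\}|\ge \frac{in}{m}$ for all $1\le i\le m$. Let $V^m=\{\mathbf{x}=(x_0,\ldots,x_{m-1})\in\mathbb{R}^m:\sum_i x_i=0,\ x_0\le x_1\le\cdots\le x_{m-1}\}$. A letter $i\in[m]$ acts on $\mathbf{x}\in V^m$ by $i(\mathbf{x})=\mathrm{sort}(\mathbf{x}+m\mathbf{e}_i-\mathbb{1}_m)$, i.e. add $m$ to the coordinate $x_i$, subtract $1$ from every coordinate, then rearrange the coordinates into weakly increasing order; here $\mathbf{e}_i$ is the $i$th standard basis vector and $\mathbb{1}_m=(1,\ldots,1)$. A word acts on $V^m$ by acting by its letters successively from left to right. *)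

theory Defs
  imports Complex_Main "HOL-Library.Multiset"
begin

definition words :: "nat \<Rightarrow> nat \<Rightarrow> nat list set" where
  "words m n = {w. length w = n \<and> set w \<subseteq> {..<m}}"

definition parking_words :: "nat \<Rightarrow> nat \<Rightarrow> nat list set" where
  "parking_words m n =
     {p \<in> words m n. \<forall>i\<in>{1..m}. real (card {j. j < n \<and> p ! j < i}) \<ge> real i * real n / real m}"

text \<open>Vectors in \<open>\<real>\<^sup>m\<close> are lists of reals of length \<open>m\<close>, with coordinates \<open>x ! 0, \<dots>, x ! (m - 1)\<close>.\<close>

definition V :: "nat \<Rightarrow> real list set" where
  "V m = {x. length x = m \<and> (\<Sum>i<m. x ! i) = 0 \<and> sorted x}"

definition letter_action :: "nat \<Rightarrow> nat \<Rightarrow> real list \<Rightarrow> real list" where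
  "letter_action m i x = sort (map (\<lambda>k. x ! k + (if k = i then real m else 0) - 1) [0..<m])"

definition word_action :: "nat \<Rightarrow> nat list \<Rightarrow> real list \<Rightarrow> real list" where
  "word_action m w x = fold (letter_action m) w x"

definition fixed_points :: "nat \<Rightarrow> nat list \<Rightarrow> real list set" where
  "fixed_points m w = {x \<in> V m. word_action m w x = x}"

text \<open>The letters do act on \<open>V m\<close>.\<close>

lemma letter_action_in_V:
  assumes "x \<in> V m" "i < m"
  shows "letter_action m i x \<in> V m"
proof -
  let ?y = "map (\<lambda>k. x ! k + (if k = i then real m else 0) - 1) [0..<m]"
  have "(\<Sum>k<m. sort ?y ! k) = sum_list (sort ?y)"
    by (subst sum_list_sum_nth) (simp add: atLeast0LessThan)
  also have "\<dots> = sum_list ?y"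
    by (simp only: sum_mset_sum_list [symmetric] mset_sort)
  also have "\<dots> = (\<Sum>k<m. x ! k + (if k = i then real m else 0) - 1)"
    by (simp add: interv_sum_list_conv_sum_set_nat atLeast0LessThan)
  also have "\<dots> = 0"
    using assms by (simp add: V_def sum.distrib sum_subtractf)
  finally show ?thesis
    by (simp add: V_def letter_action_def)
qed

lemma word_action_in_V:
  assumes "w \<in> words m n" "x \<in> V m"
  shows "word_action m w x \<in> V m"
proof -
  have "fold (letter_action m) w x \<in> V m" if "set w \<subseteq> {..<m}"
    using that assms(2) by (induction w arbitrary: x) (auto simp: letter_action_in_V)
  then show ?thesis using assms(1) by (simp add: words_def word_action_def)
qed

end

theory Submission
  imports Defs "HOL-Combinatorics.List_Permutation" "HOL-Library.Real_Mod"
begin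

text \<open>
  A violated parking inequality at \<open>i\<close> makes the sum of the \<open>i\<close> smallest coordinates strictly
  decrease, so there is no fixed point. If \<open>w\<close> is a parking word, the action preserves a bounded
  set containing a point whose coordinates are pairwise incongruent modulo \<open>m\<close> and lie in
  \<open>\<int>\<close> shifted by \<open>(m - 1) / 2\<close>; the orbit is finite, so some point of it is periodic. Sorting
  is nonexpansive, hence isometric on the periodic orbit, and since no ties ever occur there, all
  points of the orbit are sorted by the same permutations. Therefore the action commutes with
  averaging the orbit, and the average is a fixed point \<open>x\<close> that never develops ties.

  If \<open>gcd m n = 1\<close>, the coordinate differences of every fixed point are integers; as weighted
  averages of two fixed points are again fixed, the two coincide. If \<open>gcd m n = d > 1\<close>, the
  coordinates of \<open>x\<close> carry a nonconstant label preserved by the action, composed of the residue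
  modulo \<open>d\<close> and the rank within the residue class modulo \<open>m\<close>. Moving each coordinate by a small
  multiple of its label produces infinitely many fixed points.
\<close>

section \<open>Sorting, partial sums and monotonicity\<close>

lemma sum_list_take_insort_le:
  fixes a :: "'a :: {linorder, ordered_ab_group_add}"
  shows "sum_list (take (Suc i) (insort a xs)) \<le> a + sum_list (take i xs)"
proof (induction xs arbitrary: i)
  case (Cons x xs)
  show ?case
  proof (cases i)
    case 0
    then show ?thesis by auto
  next
    case (Suc j)
    then show ?thesis using Cons.IH[of j] by (auto simp: algebra_simps)
  qed
qed simp

text \<open>The \<open>i\<close> smallest entries have the least sum among all choices of
  \<open>i\<close> entries.\<close>

lemma sum_list_take_sort_le:
  fixes xs :: "'a :: {linorder, ordered_ab_group_add} list"
  shows "sum_list (take i (sort xs)) \<le> sum_list (take i xs)"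
proof (induction xs arbitrary: i)
  case (Cons x xs)
  show ?case
  proof (cases i)
    case (Suc j)
    have "sum_list (take (Suc j) (insort x (sort xs))) \<le> x + sum_list (take j (sort xs))"
      by (rule sum_list_take_insort_le)
    also have "\<dots> \<le> x + sum_list (take j xs)"
      using Cons.IH[of j] by simp
    finally show ?thesis using Suc by simp
  qed simp
qed simp

lemma insort_mono:
  assumes "list_all2 (\<le>) xs ys" "sorted xs" "sorted ys" "a \<le> (b :: 'a :: linorder)"
  shows "list_all2 (\<le>) (insort a xs) (insort b ys)"
  using assms
proof (induction xs ys arbitrary: a b rule: list_all2_induct)
  case (Cons x xs y ys)
  have sx: "insort x xs = x # xs" and sy: "insort y ys = y # ys"
    using Cons.prems by (simp_all add: insort_is_Cons)
  show ?case
    using Cons.IH[of a b] Cons.IH[of x b] Cons.IH[of a y] Cons.prems Cons.hyps sx sy by auto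
qed simp

lemma sort_mono:
  fixes xs :: "'a :: linorder list"
  assumes "list_all2 (\<le>) xs ys"
  shows "list_all2 (\<le>) (sort xs) (sort ys)"
  using assms by (induction rule: list_all2_induct) (auto intro: insort_mono)

lemma sort_append:
  fixes us vs :: "'a :: linorder list"
  assumes "\<And>u v. u \<in> set us \<Longrightarrow> v \<in> set vs \<Longrightarrow> u \<le> v"
  shows "sort (us @ vs) = sort us @ sort vs"
  using assms by (intro properties_for_sort) (auto simp: sorted_append)

lemma sort_map_mono_on:
  assumes "mono_on (set xs) g"
  shows "sort (map g xs) = map g (sort xs)"
proof (rule properties_for_sort)
  show "sorted (map g (sort xs))"
    unfolding sorted_map
    by (rule sorted_wrt_mono_rel[OF _ sorted_sort[of xs]]) (use assms in \<open>auto simp: mono_on_def\<close>)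
qed simp

subsection \<open>Sorting does not increase Euclidean distances\<close>

definition sqdist :: "real list \<Rightarrow> real list \<Rightarrow> real" where
  "sqdist xs ys = (\<Sum>(x, y)\<leftarrow>zip xs ys. (x - y)\<^sup>2)"

lemma sqdist_simps [simp]:
  "sqdist [] ys = 0" "sqdist (x # xs) (y # ys) = (x - y)\<^sup>2 + sqdist xs ys"
  by (simp_all add: sqdist_def)

lemma sqdist_conv_sum:
  assumes "length xs = m" "length ys = m"
  shows "sqdist xs ys = (\<Sum>k<m. (xs ! k - ys ! k)\<^sup>2)"
  unfolding sqdist_def using assms
  by (subst sum_list_sum_nth) (simp add: atLeast0LessThan)

text \<open>Pairing in sorted order is cheapest. When only one of \<open>a\<close>, \<open>b\<close>
  is inserted in front, exchanging partners does not raise the cost by \<open>cross\<close>, whose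
  two sides differ by 2 * (a - x) * (b - y).\<close>

lemma sqdist_insort_le:
  assumes "length xs = length ys" "sorted xs" "sorted ys"
  shows "sqdist (insort a xs) (insort b ys) \<le> (a - b)\<^sup>2 + sqdist xs ys"
  using assms
proof (induction xs ys arbitrary: a b rule: list_induct2)
  case (Cons x xs y ys)
  have sx: "insort x xs = x # xs" and sy: "insort y ys = y # ys"
    using Cons.prems by (simp_all add: insort_is_Cons)
  have cross: "(a - y)\<^sup>2 + (x - b)\<^sup>2 \<le> (a - b)\<^sup>2 + (x - y)\<^sup>2" if "(a - x) * (b - y) \<le> 0"
    using that by (simp add: power2_eq_square algebra_simps)
  consider "a \<le> x" "b \<le> y" | "a > x" "b > y" | "a \<le> x" "b > y" | "a > x" "b \<le> y"
    by linarith
  then show ?case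
  proof cases
    case 3
    then have "(a - x) * (b - y) \<le> 0" by (simp add: mult_nonpos_nonneg)
    then show ?thesis using 3 Cons.IH[of x b] Cons.prems sx cross by (auto simp: power2_commute)
  next
    case 4
    then have "(a - x) * (b - y) \<le> 0" by (simp add: mult_nonneg_nonpos)
    then show ?thesis using 4 Cons.IH[of a y] Cons.prems sy cross by (auto simp: power2_commute)
  qed (use Cons.IH[of a b] Cons.prems in auto)
qed simp

lemma sqdist_sort_le:
  assumes "length xs = length ys"
  shows "sqdist (sort xs) (sort ys) \<le> sqdist xs ys"
  using assms
proof (induction rule: list_induct2)
  case (Cons x xs y ys)
  have "sqdist (insort x (sort xs)) (insort y (sort ys)) \<le> (x - y)\<^sup>2 + sqdist (sort xs) (sort ys)"
    by (rule sqdist_insort_le) (use Cons.hyps in auto)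
  with Cons.IH show ?case by simp
qed simp

text \<open>Exchanging two entries of \<open>ys\<close> that are inverted with respect to \<open>xs\<close> strictly decreases the
  distance and does not change \<open>sort ys\<close>.\<close>

lemma sqdist_sort_less:
  assumes len: "length xs = m" "length ys = m" and ij: "i < m" "j < m"
    and inv: "xs ! i < xs ! j" "ys ! i > ys ! j"
  shows "sqdist (sort xs) (sort ys) < sqdist xs ys"
proof -
  define zs where "zs = ys[i := ys ! j, j := ys ! i]"
  have ne: "i \<noteq> j" using inv by auto
  have lz: "length zs = m" by (simp add: zs_def len)
  have "mset zs = mset ys"
    unfolding zs_def using ij len by (intro mset_swap) auto
  then have "sort zs = sort ys"
    by (intro properties_for_sort) auto
  then have "sqdist (sort xs) (sort ys) \<le> sqdist xs zs"
    using sqdist_sort_le[of xs zs] lz len by simp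
  also have "sqdist xs zs < sqdist xs ys"
  proof -
    have split: "(\<Sum>k<m. h k) = h i + h j + (\<Sum>k\<in>{..<m}-{i,j}. h k)" for h :: "nat \<Rightarrow> real"
      using ij ne by (subst sum.subset_diff[of "{i,j}"]) auto
    have eq: "(\<Sum>k\<in>{..<m}-{i,j}. (xs!k - zs!k)\<^sup>2) = (\<Sum>k\<in>{..<m}-{i,j}. (xs!k - ys!k)\<^sup>2)"
      by (rule sum.cong) (auto simp: zs_def)
    have "zs ! i = ys ! j" "zs ! j = ys ! i"
      using ij ne len by (auto simp: zs_def nth_list_update)
    moreover have "(xs!i - ys!j)\<^sup>2 + (xs!j - ys!i)\<^sup>2 < (xs!i - ys!i)\<^sup>2 + (xs!j - ys!j)\<^sup>2"
    proof -
      have "(xs!j - xs!i) * (ys!i - ys!j) > 0" using inv by simp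
      then show ?thesis by (simp add: power2_eq_square algebra_simps)
    qed
    ultimately show ?thesis
      using sqdist_conv_sum[OF len(1) lz] sqdist_conv_sum[OF len] split[of "\<lambda>k. (xs!k - zs!k)\<^sup>2"]
        split[of "\<lambda>k. (xs!k - ys!k)\<^sup>2"] eq by simp
  qed
  finally show ?thesis .
qed

subsection \<open>Partial sums under the action\<close>

text \<open>The action before sorting, where an index still names the same coordinate.\<close>

definition raise :: "nat \<Rightarrow> nat \<Rightarrow> real list \<Rightarrow> real list" where
  "raise m l x = map (\<lambda>k. x ! k + (if k = l then real m else 0) - 1) [0..<m]"

lemma letter_action_raise: "letter_action m l x = sort (raise m l x)"
  by (simp add: letter_action_def raise_def)

lemma length_raise [simp]: "length (raise m l x) = m"
  by (simp add: raise_def)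

lemma length_letter_action [simp]: "length (letter_action m l x) = m"
  by (simp add: letter_action_raise)

lemma nth_raise [simp]:
  "k < m \<Longrightarrow> raise m l x ! k = x ! k + (if k = l then real m else 0) - 1"
  by (simp add: raise_def)

lemma word_action_simps [simp]:
  "word_action m [] x = x" "word_action m (l # w) x = word_action m w (letter_action m l x)"
  by (simp_all add: word_action_def)

lemma length_word_action: "length x = m \<Longrightarrow> length (word_action m w x) = m"
  by (induction w arbitrary: x) auto

lemma sum_list_take_nth:
  "i \<le> length xs \<Longrightarrow> sum_list (take i xs) = (\<Sum>k<i. xs ! k)"
  by (simp add: sum_list_sum_nth atLeast0LessThan min_def)

lemma sum_take_raise:
  assumes "length x = m" "i \<le> m" "l < m"
  shows "sum_list (take i (raise m l x)) = sum_list (take i x) + (if l < i then real m else 0) - real i"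
proof -
  have "sum_list (take i (raise m l x)) = (\<Sum>k<i. x ! k + (if k = l then real m else 0) - 1)"
    using assms by (subst sum_list_take_nth) auto
  also have "\<dots> = (\<Sum>k<i. x ! k) + (if l < i then real m else 0) - real i"
    by (simp add: sum.distrib sum_subtractf)
  finally show ?thesis using assms by (simp add: sum_list_take_nth)
qed

lemma sum_take_letter_le:
  assumes "length x = m" "i \<le> m" "l < m"
  shows "sum_list (take i (letter_action m l x))
    \<le> sum_list (take i x) + (if l < i then real m else 0) - real i"
  using sum_list_take_sort_le[of i "raise m l x"] sum_take_raise[OF assms]
  by (simp add: letter_action_raise)

lemma sum_take_letter_ge:
  assumes "length x = m" "sorted x" "i \<le> m"
  shows "sum_list (take i (letter_action m l x)) \<ge> sum_list (take i x) - real i"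
proof -
  \<comment> \<open>Subtracting 1 everywhere keeps \<open>x\<close> sorted and stays entrywise below
    \<open>raise m l x\<close>; sorting preserves this comparison.\<close>
  have "list_all2 (\<le>) (map (\<lambda>z. z - 1) x) (raise m l x)"
    using assms by (auto simp: list_all2_conv_all_nth)
  from sort_mono[OF this] have le: "list_all2 (\<le>) (map (\<lambda>z. z - 1) x) (letter_action m l x)"
    using assms by (simp add: letter_action_raise sort_map_mono_on mono_on_def sort_key_id_if_sorted)
  have "sum_list (take i x) - real i = (\<Sum>k<i. x ! k - 1)"
    using assms by (simp add: sum_list_take_nth sum_subtractf)
  also have "\<dots> \<le> (\<Sum>k<i. letter_action m l x ! k)"
    by (rule sum_mono) (use le assms in \<open>auto simp: list_all2_conv_all_nth\<close>)
  finally show ?thesis using assms by (simp add: sum_list_take_nth)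
qed

definition separated :: "nat \<Rightarrow> real \<Rightarrow> real list \<Rightarrow> bool" where
  "separated i g x \<longleftrightarrow> (\<forall>a\<in>set (take i x). \<forall>b\<in>set (drop i x). a + g \<le> b)"

text \<open>A letter lifts one coordinate by \<open>m\<close> relative to the others. With a gap of
  at least \<open>m\<close> at position \<open>i\<close> nothing crosses it, so sorting permutes
  within the two blocks and the sum of the first block is known exactly.\<close>

lemma separated_letter:
  assumes x: "length x = m" "i \<le> m" "l < m" and sep: "separated i g x" "g \<ge> real m"
  shows "separated i (g - real m) (letter_action m l x)"
    and "sum_list (take i (letter_action m l x))
      = sum_list (take i x) + (if l < i then real m else 0) - real i"
proof -
  let ?us = "take i (raise m l x)" and ?vs = "drop i (raise m l x)"
  have gap: "u + (g - real m) \<le> v" if uv: "u \<in> set ?us" "v \<in> set ?vs" for u v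
  proof -
    from uv(1) obtain a where a: "a < i" "u = raise m l x ! a"
      using x by (auto simp: in_set_conv_nth)
    from uv(2) obtain b where "b < m - i" "v = raise m l x ! (i + b)"
      using x by (auto simp: in_set_conv_nth simp del: nth_raise)
    then have b: "i + b < m" "v = raise m l x ! (i + b)" using x by auto
    have "x ! a \<in> set (take i x)"
      using a x by (auto simp: in_set_conv_nth intro!: exI[of _ a])
    moreover have "x ! (i + b) \<in> set (drop i x)"
      using b x by (auto simp: in_set_conv_nth intro!: exI[of _ b])
    ultimately have "x ! a + g \<le> x ! (i + b)" using sep by (auto simp: separated_def)
    then show ?thesis using a b x by (auto split: if_splits)
  qed
  have "sort (?us @ ?vs) = sort ?us @ sort ?vs"
    by (rule sort_append) (use gap sep in fastforce)
  then have split: "letter_action m l x = sort ?us @ sort ?vs"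
    by (simp add: letter_action_raise)
  show "separated i (g - real m) (letter_action m l x)"
    unfolding split separated_def using gap x by (simp add: min_def)
  have "sum_list (take i (letter_action m l x)) = sum_list (sort ?us)"
    unfolding split using x by (simp add: min_def)
  also have "\<dots> = sum_list ?us"
    by (metis mset_sort sum_mset_sum_list)
  finally show "sum_list (take i (letter_action m l x))
      = sum_list (take i x) + (if l < i then real m else 0) - real i"
    using sum_take_raise[OF x] by simp
qed

lemma sum_take_word_le:
  assumes "length x = m" "i \<le> m" "set w \<subseteq> {..<m}"
  shows "sum_list (take i (word_action m w x))
    \<le> sum_list (take i x) + real m * real (length (filter (\<lambda>l. l < i) w)) - real i * real (length w)"
  using assms
proof (induction w arbitrary: x)
  case (Cons l w)
  show ?case
    using Cons.IH[of "letter_action m l x"] sum_take_letter_le[of x m i l] Cons.prems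
    by (auto simp: algebra_simps split: if_splits)
qed simp

lemma sum_take_word_ge:
  assumes "length x = m" "sorted x" "i \<le> m"
  shows "sum_list (take i (word_action m w x)) \<ge> sum_list (take i x) - real i * real (length w)"
  using assms
proof (induction w arbitrary: x)
  case (Cons l w)
  have "sorted (letter_action m l x)" by (simp add: letter_action_raise)
  then show ?case
    using Cons.IH[of "letter_action m l x"] sum_take_letter_ge[of x m i l] Cons.prems
    by (auto simp: algebra_simps)
qed simp

text \<open>Each letter uses up at most \<open>m\<close> of the gap, so this gap lasts for the whole
  word and turns the bound of \<open>sum_take_word_le\<close> into an equality.\<close>

lemma sum_take_word_separated:
  assumes "length x = m" "i \<le> m" "set w \<subseteq> {..<m}" "separated i (real m * real (length w)) x"
  shows "sum_list (take i (word_action m w x))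
    = sum_list (take i x) + real m * real (length (filter (\<lambda>l. l < i) w)) - real i * real (length w)"
  using assms
proof (induction w arbitrary: x)
  case (Cons l w)
  note sep = separated_letter[of x m i l "real m * real (length (l # w))"]
  have "separated i (real m * real (length w)) (letter_action m l x)"
    using sep(1) Cons.prems by (simp add: algebra_simps)
  then show ?case
    using Cons.IH[of "letter_action m l x"] sep(2) Cons.prems
    by (auto simp: algebra_simps split: if_splits)
qed simp

section \<open>The parking condition: its necessity and an invariant bounded set\<close>

lemma parking_words_iff:
  assumes "w \<in> words m n" "m > 0"
  shows "w \<in> parking_words m n \<longleftrightarrow>
    (\<forall>i\<in>{1..m}. real i * real n \<le> real m * real (length (filter (\<lambda>l. l < i) w)))"
  using assms
  by (simp add: parking_words_def words_def length_filter_conv_card field_simps)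

lemma V_D:
  assumes "x \<in> V m"
  shows "length x = m" "sorted x" "sum_list x = 0"
  using assms sum_list_take_nth[of m x] by (auto simp: V_def)

lemma no_fixed_point_if_not_parking:
  assumes "m > 0" "w \<in> words m n" "w \<notin> parking_words m n" "x \<in> V m"
  shows "word_action m w x \<noteq> x"
proof -
  obtain i where i: "i \<in> {1..m}" "real m * real (length (filter (\<lambda>l. l < i) w)) < real i * real n"
    using assms parking_words_iff by fastforce
  have "sum_list (take i (word_action m w x)) < sum_list (take i x)"
    using sum_take_word_le[of x m i w] i assms V_D by (auto simp: words_def)
  then show ?thesis by auto
qed

text \<open>The bound vanishes at \<open>i = 0\<close> and \<open>i = m\<close>, where the partial
  sums of a vector in \<open>V m\<close> are 0 as well.\<close>

definition box :: "nat \<Rightarrow> real \<Rightarrow> real list set" where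
  "box m A = {x \<in> V m. \<forall>i\<le>m. sum_list (take i x) \<ge> - A * real i * real (m - i)}"

text \<open>The bound defining \<open>box\<close> is strictly convex in \<open>i\<close>, so wherever it is nearly attained, convexity
  of the partial sums of a sorted list forces a gap between the coordinates \<open>i - 1\<close> and \<open>i\<close>. While
  this gap persists, the parking condition keeps the \<open>i\<close>-th partial sum from decreasing.\<close>

lemma word_action_in_box:
  assumes m: "m > 0" and w: "w \<in> parking_words m n" and x: "x \<in> box m (2 * real n * real m)"
  shows "word_action m w x \<in> box m (2 * real n * real m)"
proof -
  define A where "A = 2 * real n * real m"
  have ww: "w \<in> words m n" using w by (simp add: parking_words_def)
  then have len: "length w = n" and set: "set w \<subseteq> {..<m}" by (auto simp: words_def)
  have xV: "x \<in> V m" using x by (simp add: box_def)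
  note xD = V_D[OF xV]
  have fV: "word_action m w x \<in> V m" using word_action_in_V[OF ww xV] .
  have S: "sum_list (take i x) \<ge> - A * real i * real (m - i)" if "i \<le> m" for i
    using x that by (simp add: box_def A_def)
  have "sum_list (take i (word_action m w x)) \<ge> - A * real i * real (m - i)" if im: "i \<le> m" for i
  proof -
    consider "i = 0" | "i = m" | "0 < i" "i < m" using im by linarith
    then show ?thesis
    proof cases
      case 2
      then show ?thesis using V_D[OF fV] by simp
    next
      case 3
      \<comment> \<open>A slack of \<open>n * i\<close> absorbs the worst possible loss, which is
        \<open>i\<close> per letter.\<close>
      show ?thesis
      proof (cases "sum_list (take i x) \<ge> - A * real i * real (m - i) + real n * real i")
        case True
        then show ?thesis
          using sum_take_word_ge[of x m i w] xD im len by (simp add: algebra_simps)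
      next
        case False
        obtain j where j: "i = Suc j" using 3 by (cases i) auto
        define a b where "a = real i" and "b = real (m - i)"
        have r: "real (Suc i) = a + 1" "real (m - Suc i) = b - 1" "real j = a - 1" "real (m - j) = b + 1"
          using 3 j by (auto simp: a_def b_def of_nat_diff)
        have S1: "sum_list (take (Suc i) x) \<ge> - A * (a + 1) * (b - 1)"
          using S[of "Suc i"] 3 unfolding r by simp
        have S2: "sum_list (take j x) \<ge> - A * (a - 1) * (b + 1)"
          using S[of j] 3 j unfolding r by simp
        have S3: "sum_list (take i x) < - A * a * b + real n * a"
          using False by (simp add: a_def b_def)
        have e1: "sum_list (take (Suc i) x) = sum_list (take i x) + x ! i"
          using 3 xD by (simp add: take_Suc_conv_app_nth)
        have e2: "sum_list (take i x) = sum_list (take j x) + x ! j"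
          using 3 xD j by (simp add: take_Suc_conv_app_nth)
        \<comment> \<open>The difference of these coordinates is the second difference of the
          partial sums at \<open>i\<close>. The bound contributes 2 * A, and the missing slack costs
          n * a twice. With A = 2 * n * m at least n * m remains, enough for \<open>n\<close>
          letters.\<close>
        have gap0: "x ! i - x ! j \<ge> 2 * A - 2 * (real n * a)"
          using S1 S2 S3 e1 e2 by (simp add: algebra_simps)
        have "real n * a \<le> real n * real m"
          using 3 by (intro mult_left_mono) (auto simp: a_def)
        then have gap: "x ! j + real m * real (length w) \<le> x ! i"
          using gap0 mult_nonneg_nonneg[of "real n" "real m", OF of_nat_0_le_iff of_nat_0_le_iff]
          unfolding A_def len mult.commute[of "real m" "real n"] by linarith
        have "separated i (real m * real (length w)) x"
          unfolding separated_def
        proof safe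
          fix u v assume "u \<in> set (take i x)" "v \<in> set (drop i x)"
          then obtain k k' where "k < i" "u = x ! k" "k' < m - i" "v = x ! (i + k')"
            using 3 xD by (auto simp: in_set_conv_nth)
          moreover from this have "u \<le> x ! j" "x ! i \<le> v"
            using xD 3 j by (auto intro!: sorted_nth_mono)
          ultimately show "u + real m * real (length w) \<le> v" using gap by linarith
        qed
        note eq = sum_take_word_separated[OF xD(1) im set this]
        have "real i * real n \<le> real m * real (length (filter (\<lambda>l. l < i) w))"
          using w parking_words_iff[OF ww m] 3 by auto
        then show ?thesis using eq S[OF im] len by simp
      qed
    qed simp
  qed
  then show ?thesis using fV by (simp add: box_def A_def)
qed

subsection \<open>Periodic points\<close>

text \<open>The shift puts \<open>center m\<close> on the grid: \<open>m\<close> consecutive grid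
  points with sum 0.\<close>

definition on_grid :: "nat \<Rightarrow> real list \<Rightarrow> bool" where
  "on_grid m x \<longleftrightarrow> (\<forall>z\<in>set x. z + (real m - 1) / 2 \<in> \<int>)"

lemma on_grid_letter:
  assumes "length x = m" "on_grid m x"
  shows "on_grid m (letter_action m l x)"
proof -
  have "raise m l x ! k + (real m - 1) / 2 \<in> \<int>" if "k < m" for k
  proof -
    have "x ! k + (real m - 1) / 2 \<in> \<int>" using assms that by (auto simp: on_grid_def)
    moreover have "(if k = l then real m else 0) - 1 \<in> \<int>" by auto
    ultimately have "(x ! k + (real m - 1) / 2) + ((if k = l then real m else 0) - 1) \<in> \<int>"
      by (rule Ints_add)
    moreover have "raise m l x ! k + (real m - 1) / 2
        = (x ! k + (real m - 1) / 2) + ((if k = l then real m else 0) - 1)"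
      using that by simp
    ultimately show ?thesis by (simp only:)
  qed
  then show ?thesis
    by (auto simp: on_grid_def letter_action_raise in_set_conv_nth simp del: nth_raise)
qed

lemma on_grid_word:
  assumes "length x = m" "on_grid m x"
  shows "on_grid m (word_action m w x)"
  using assms by (induction w arbitrary: x) (auto simp: on_grid_letter)

text \<open>The bound at \<open>i = 1\<close> limits the smallest coordinate from below; the one at
  \<open>i = m - 1\<close>, with the zero sum, limits the largest from above. Both limits have size
  \<open>B\<close>.\<close>

lemma finite_box_grid: "finite {x \<in> box m A. on_grid m x}"
proof (cases "m = 0")
  case True
  then show ?thesis by (auto simp: box_def V_def intro: finite_subset[of _ "{[]}"])
next
  case False
  define B where "B = A * real (m - 1)"
  define Z where "Z = (\<lambda>k. real_of_int k - (real m - 1) / 2) ` {- \<lceil>B\<rceil> .. \<lceil>B + (real m - 1)\<rceil>}"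
  have "set x \<subseteq> Z" if x: "x \<in> box m A" "on_grid m x" for x
  proof
    fix z assume z: "z \<in> set x"
    have xV: "x \<in> V m" using x by (simp add: box_def)
    note xD = V_D[OF xV]
    obtain k where k: "k < m" "z = x ! k" using z xD by (auto simp: in_set_conv_nth)
    have S: "sum_list (take i x) \<ge> - A * real i * real (m - i)" if "i \<le> m" for i
      using x that by (simp add: box_def)
    have "sum_list (take 1 x) = x ! 0"
      using False xD by (cases x) auto
    then have lo: "x ! 0 \<ge> - B" using S[of 1] False by (simp add: B_def)
    obtain m' where m': "m = Suc m'" using False by (cases m) auto
    have "x = take m' x @ [x ! m']"
      using xD m' by (metis lessI order_refl take_Suc_conv_app_nth take_all)
    then have "sum_list (take m' x) + x ! m' = 0"
      using xD(3) by (metis sum_list.Cons sum_list.Nil sum_list_append add_0_right)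
    then have hi: "x ! m' \<le> B" using S[of m'] m' by (simp add: B_def)
    have "x ! 0 \<le> z" "z \<le> x ! m'"
      using k xD m' by (auto intro!: sorted_nth_mono)
    then have zb: "- B \<le> z" "z \<le> B" using lo hi by auto
    have "z + (real m - 1) / 2 \<in> \<int>" using x z by (auto simp: on_grid_def)
    then obtain c where c: "z + (real m - 1) / 2 = of_int c" by (auto elim: Ints_cases)
    have r: "(real m - 1) / 2 \<ge> 0" using False by simp
    have 1: "- B \<le> of_int c" using c zb r by linarith
    have 2: "of_int c \<le> B + (real m - 1)" using c zb r by (simp add: field_simps)
    have "- \<lceil>B\<rceil> \<le> c" using 1 by linarith
    moreover have "c \<le> \<lceil>B + (real m - 1)\<rceil>" using 2 by linarith
    moreover have "z = of_int c - (real m - 1) / 2" using c by simp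
    ultimately show "z \<in> Z" by (auto simp: Z_def)
  qed
  moreover have "length x = m" if "x \<in> box m A" for x
    using that by (auto simp: box_def V_def)
  ultimately have "{x \<in> box m A. on_grid m x} \<subseteq> {x. set x \<subseteq> Z \<and> length x = m}"
    by blast
  moreover have "finite Z" by (simp add: Z_def)
  ultimately show ?thesis using finite_lists_length_eq finite_subset by blast
qed

text \<open>Stronger than distinctness and, unlike it, preserved by every letter: modulo
  \<open>m\<close> a letter only shifts all coordinates by -1.\<close>

definition residue_distinct :: "nat \<Rightarrow> real list \<Rightarrow> bool" where
  "residue_distinct m x \<longleftrightarrow> distinct (map (\<lambda>z. z rmod real m) x)"

lemma rcong_raise: "k < m \<Longrightarrow> [raise m l x ! k = x ! k - 1] (rmod real m)"
  by (auto simp: rcong_altdef intro: exI[of _ "-1"] exI[of _ 0])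

lemma residue_distinct_raise:
  assumes "length x = m" "residue_distinct m x"
  shows "residue_distinct m (raise m l x)"
proof -
  have "\<not> [raise m l x ! i = raise m l x ! j] (rmod real m)" if "i < m" "j < m" "i \<noteq> j" for i j
  proof
    assume "[raise m l x ! i = raise m l x ! j] (rmod real m)"
    then have "[x ! i - 1 = x ! j - 1] (rmod real m)"
      using rcong_raise that rcong_trans rcong_sym by meson
    then show False
      using assms that by (auto simp: residue_distinct_def distinct_conv_nth rcong_def[symmetric])
  qed
  then show ?thesis
    by (auto simp: residue_distinct_def distinct_conv_nth rcong_def simp del: nth_raise)
qed

lemma residue_distinct_letter:
  assumes "length x = m" "residue_distinct m x"
  shows "residue_distinct m (letter_action m l x)"
proof -
  have "mset (map (\<lambda>z. z rmod real m) (letter_action m l x))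
      = mset (map (\<lambda>z. z rmod real m) (raise m l x))"
    by (simp add: letter_action_raise)
  then show ?thesis
    using residue_distinct_raise[OF assms] mset_eq_imp_distinct_iff
    unfolding residue_distinct_def by blast
qed

lemma residue_distinct_word:
  assumes "length x = m" "residue_distinct m x"
  shows "residue_distinct m (word_action m w x)"
  using assms by (induction w arbitrary: x) (auto simp: residue_distinct_letter)

definition center :: "nat \<Rightarrow> real list" where
  "center m = map (\<lambda>k. real k - (real m - 1) / 2) [0..<m]"

lemma center_in_V: "center m \<in> V m"
proof -
  have "(\<Sum>i<m. real i) = real m * (real m - 1) / 2"
    by (induction m) (auto simp: field_simps)
  moreover have "sorted (center m)" by (simp add: center_def sorted_iff_nth_mono)
  ultimately show ?thesis by (simp add: V_def center_def sum_subtractf)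
qed

lemma on_grid_center: "on_grid m (center m)"
  by (auto simp: on_grid_def center_def)

lemma residue_distinct_center: "residue_distinct m (center m)"
proof -
  have "i = j" if "i < m" "j < m" "[real i - (real m - 1) / 2 = real j - (real m - 1) / 2] (rmod real m)" for i j
  proof -
    have "[real i = real j] (rmod real m)" using that(3) by simp
    then have "real i = real j" by (rule rcong_imp_eq) (use that in auto)
    then show ?thesis by simp
  qed
  then show ?thesis
    by (auto simp: residue_distinct_def center_def distinct_conv_nth rcong_def)
qed

lemma center_in_box:
  assumes "A \<ge> real m"
  shows "center m \<in> box m A"
proof -
  have "sum_list (take i (center m)) \<ge> - A * real i * real (m - i)" if i: "i \<le> m" for i
  proof (cases "i = m")
    case True
    then show ?thesis using V_D[OF center_in_V[of m]] by simp
  next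
    case False
    have len: "length (center m) = m" by (simp add: center_def)
    have "- A * real i * real (m - i) \<le> - A * real i * 1"
      using assms False i by (intro mult_left_mono_neg) auto
    also have "\<dots> = (\<Sum>k<i. - A)" by simp
    also have "\<dots> \<le> (\<Sum>k<i. center m ! k)"
    proof (rule sum_mono)
      fix k assume "k \<in> {..<i}"
      then have "center m ! k = real k - (real m - 1) / 2" using i by (simp add: center_def)
      also have "\<dots> \<ge> - A" using assms by (simp add: field_simps)
      finally show "- A \<le> center m ! k" .
    qed
    also have "\<dots> = sum_list (take i (center m))"
      using i len by (simp add: sum_list_take_nth)
    finally show ?thesis .
  qed
  then show ?thesis using center_in_V by (simp add: box_def)
qed

lemma exists_periodic_point:
  assumes mn: "m > 0" "n > 0" and w: "w \<in> parking_words m n"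
  obtains y p where "p > 0" "y \<in> V m" "residue_distinct m y" "(word_action m w ^^ p) y = y"
proof -
  define f where "f = word_action m w"
  define K where "K = {x \<in> box m (2 * real n * real m). on_grid m x \<and> residue_distinct m x}"
  define u where "u t = (f ^^ t) (center m)" for t
  \<comment> \<open>Since n > 0, the constant 2 * n * m is at least \<open>m\<close>, as
    \<open>center_in_box\<close> asks.\<close>
  have "center m \<in> K"
    using mn by (auto simp: K_def on_grid_center residue_distinct_center intro!: center_in_box)
  moreover have "f x \<in> K" if "x \<in> K" for x
    using that word_action_in_box[OF mn(1) w] on_grid_word residue_distinct_word
    by (auto simp: K_def f_def box_def dest!: V_D(1))
  ultimately have uK: "u t \<in> K" for t
    by (induction t) (auto simp: u_def)
  have "finite K" unfolding K_def by (rule finite_subset[OF _ finite_box_grid]) auto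
  then have "finite (range u)" using uK by (meson finite_subset image_subsetI)
  then have "\<not> inj u" using finite_imageD by blast
  then obtain s t where st: "s < t" "u s = u t"
    by (metis injI linorder_neqE_nat)
  show ?thesis
  proof (rule that[of "t - s" "u s"])
    show "u s \<in> V m" "residue_distinct m (u s)" using uK[of s] by (auto simp: K_def box_def)
    have "(f ^^ (t - s)) (u s) = u t"
      using st(1) by (simp add: u_def funpow_add[symmetric, unfolded o_def fun_eq_iff, rule_format])
    then show "(word_action m w ^^ (t - s)) (u s) = u s" using st by (simp add: f_def)
  qed (use st in simp)
qed

subsection \<open>Averages of periodic orbits\<close>

text \<open>The index type is free: the orbit average is indexed by times, the average of two fixed
  points by \<open>bool\<close>.\<close>

definition lincomb :: "nat \<Rightarrow> 'i set \<Rightarrow> ('i \<Rightarrow> real) \<Rightarrow> ('i \<Rightarrow> real list) \<Rightarrow> real list" where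
  "lincomb m I c a = map (\<lambda>k. \<Sum>i\<in>I. c i * a i ! k) [0..<m]"

lemma length_lincomb [simp]: "length (lincomb m I c a) = m"
  by (simp add: lincomb_def)

lemma nth_lincomb [simp]: "k < m \<Longrightarrow> lincomb m I c a ! k = (\<Sum>i\<in>I. c i * a i ! k)"
  by (simp add: lincomb_def)

lemma lincomb_cong: "(\<And>i. i \<in> I \<Longrightarrow> a i = b i) \<Longrightarrow> lincomb m I c a = lincomb m I c b"
  by (simp add: lincomb_def)

text \<open>By \<open>sqdist_sort_less\<close>, lists without ties whose distances are preserved by sorting are
  all sorted by one and the same permutation.\<close>

lemma sort_lincomb:
  assumes I: "finite I" "\<And>i. i \<in> I \<Longrightarrow> c i \<ge> 0" "I \<noteq> {}"
    and len: "\<And>i. i \<in> I \<Longrightarrow> length (a i) = m"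
    and dist: "\<And>i. i \<in> I \<Longrightarrow> distinct (a i)"
    and iso: "\<And>i j. i \<in> I \<Longrightarrow> j \<in> I \<Longrightarrow> sqdist (a i) (a j) \<le> sqdist (sort (a i)) (sort (a j))"
  shows "sort (lincomb m I c a) = lincomb m I c (\<lambda>i. sort (a i))"
proof -
  obtain i0 where i0: "i0 \<in> I" using I by auto
  have "mset (sort (a i0)) = mset (a i0)" by simp
  then obtain p where p: "p permutes {..<length (a i0)}" "permute_list p (a i0) = sort (a i0)"
    by (rule mset_eq_permutation)
  have pm: "p permutes {..<m}" using p(1) len[OF i0] by simp
  have p_less: "p k < m" if "k < m" for k
    using permutes_in_image[OF pm] that by simp
  have mono: "a i ! p r \<le> a i ! p s" if i: "i \<in> I" and rs: "r \<le> s" "s < m" for i r s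
  proof (cases "r = s")
    case False
    have lt: "p r < m" "p s < m" using p_less rs by auto
    have "sort (a i0) ! r \<le> sort (a i0) ! s"
      using rs len[OF i0] by (auto intro!: sorted_nth_mono)
    then have "a i0 ! p r \<le> a i0 ! p s"
      using rs len[OF i0] pm by (simp add: p(2)[symmetric] permute_list_nth)
    moreover have "p r \<noteq> p s"
      using permutes_inj[OF pm] False by (auto dest: injD)
    \<comment> \<open>Distinctness makes this strict, so that by \<open>sqdist_sort_less\<close> an
      inversion of the same pair in \<open>a i\<close> would contradict \<open>iso\<close>.\<close>
    ultimately have "a i0 ! p r < a i0 ! p s"
      using dist[OF i0] len[OF i0] lt by (metis less_eq_real_def nth_eq_iff_index_eq)
    then show ?thesis
      using sqdist_sort_less[OF len[OF i0] len[OF i] lt] iso[OF i0 i] by force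
  qed simp
  have eq: "sort x = permute_list p x"
    if x: "length x = m" "\<And>r s. r \<le> s \<Longrightarrow> s < m \<Longrightarrow> x ! p r \<le> x ! p s" for x :: "real list"
  proof (rule properties_for_sort)
    show "mset (permute_list p x) = mset x" using pm x(1) by simp
    show "sorted (permute_list p x)"
      using x pm by (auto simp: sorted_iff_nth_mono permute_list_nth)
  qed
  have "sort (lincomb m I c a) = permute_list p (lincomb m I c a)"
    by (rule eq) (auto simp: p_less intro!: sum_mono mult_left_mono mono I)
  also have "\<dots> = lincomb m I c (\<lambda>i. permute_list p (a i))"
    by (rule nth_equalityI) (use pm len in \<open>auto simp: permute_list_nth p_less\<close>)
  also have "\<dots> = lincomb m I c (\<lambda>i. sort (a i))"
    by (rule lincomb_cong) (use eq len mono in auto)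
  finally show ?thesis .
qed

lemma residue_distinct_imp_distinct: "residue_distinct m x \<Longrightarrow> distinct x"
  by (simp add: residue_distinct_def distinct_map)

lemma sqdist_raise:
  assumes "length x = m" "length y = m"
  shows "sqdist (raise m l x) (raise m l y) = sqdist x y"
  using assms sqdist_conv_sum[OF assms] sqdist_conv_sum[of "raise m l x" m "raise m l y"] by simp

lemma sqdist_letter_le:
  assumes "length x = m" "length y = m"
  shows "sqdist (letter_action m l x) (letter_action m l y) \<le> sqdist x y"
  using sqdist_sort_le[of "raise m l x" "raise m l y"] sqdist_raise[OF assms]
  by (simp add: letter_action_raise)

lemma sqdist_word_le:
  assumes "length x = m" "length y = m"
  shows "sqdist (word_action m w x) (word_action m w y) \<le> sqdist x y"
  using assms
proof (induction w arbitrary: x y)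
  case (Cons l w)
  show ?case
    using Cons.IH[of "letter_action m l x" "letter_action m l y"] sqdist_letter_le[OF Cons.prems, of l]
    by simp
qed simp

text \<open>\<open>raise m l\<close> is a translation, so it preserves distances and commutes with
  combinations whose weights sum to 1; \<open>sort_lincomb\<close> deals with the sorting.\<close>

lemma letter_lincomb:
  assumes I: "finite I" "\<And>i. i \<in> I \<Longrightarrow> c i \<ge> 0" "(\<Sum>i\<in>I. c i) = 1"
    and a: "\<And>i. i \<in> I \<Longrightarrow> length (a i) = m" "\<And>i. i \<in> I \<Longrightarrow> residue_distinct m (a i)"
    and iso: "\<And>i j. i \<in> I \<Longrightarrow> j \<in> I \<Longrightarrow>
      sqdist (a i) (a j) \<le> sqdist (letter_action m l (a i)) (letter_action m l (a j))"
  shows "letter_action m l (lincomb m I c a) = lincomb m I c (\<lambda>i. letter_action m l (a i))"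
proof -
  have "raise m l (lincomb m I c a) = lincomb m I c (\<lambda>i. raise m l (a i))"
  proof (rule nth_equalityI)
    fix k assume "k < length (raise m l (lincomb m I c a))"
    then have k: "k < m" by simp
    have "lincomb m I c (\<lambda>i. raise m l (a i)) ! k
        = (\<Sum>i\<in>I. c i * a i ! k + c i * ((if k = l then real m else 0) - 1))"
      using k by (auto simp: algebra_simps intro!: sum.cong)
    also have "\<dots> = (\<Sum>i\<in>I. c i * a i ! k) + ((if k = l then real m else 0) - 1)"
      by (simp add: sum.distrib sum_distrib_right[symmetric] I(3))
    finally show "raise m l (lincomb m I c a) ! k = lincomb m I c (\<lambda>i. raise m l (a i)) ! k"
      using k by simp
  qed simp
  moreover have "I \<noteq> {}" using I(3) by auto
  ultimately show ?thesis
    unfolding letter_action_raise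
    using I a iso
    by (auto simp: sqdist_raise letter_action_raise intro!: sort_lincomb
        residue_distinct_imp_distinct[OF residue_distinct_raise])
qed

text \<open>An average of points satisfying \<open>residue_distinct\<close> need not satisfy it, so
  the absence of ties is recorded separately, at every stage including the last.\<close>

fun tie_free :: "nat \<Rightarrow> nat list \<Rightarrow> real list \<Rightarrow> bool" where
  "tie_free m [] x \<longleftrightarrow> sorted_wrt (<) x"
| "tie_free m (l # w) x \<longleftrightarrow> sorted_wrt (<) x \<and> tie_free m w (letter_action m l x)"

lemma strict_sorted_lincomb:
  assumes I: "finite I" "\<And>i. i \<in> I \<Longrightarrow> c i \<ge> 0" "(\<Sum>i\<in>I. c i) = 1"
    and a: "\<And>i. i \<in> I \<Longrightarrow> length (a i) = m" "\<And>i. i \<in> I \<Longrightarrow> sorted_wrt (<) (a i)"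
  shows "sorted_wrt (<) (lincomb m I c a)"
proof -
  obtain i0 where i0: "i0 \<in> I" "c i0 > 0"
    using I by (metis less_eq_real_def sum.neutral zero_neq_one)
  have "(\<Sum>i\<in>I. c i * a i ! r) < (\<Sum>i\<in>I. c i * a i ! s)" if rs: "r < s" "s < m" for r s
  proof (rule sum_strict_mono_ex1[OF I(1)])
    have "a i ! r < a i ! s" if "i \<in> I" for i
      using sorted_wrt_nth_less[OF a(2)[OF that] rs(1)] a(1)[OF that] rs by simp
    then show "\<forall>i\<in>I. c i * a i ! r \<le> c i * a i ! s" "\<exists>i\<in>I. c i * a i ! r < c i * a i ! s"
      using I(2) i0 by (auto intro!: mult_left_mono bexI[of _ i0] intro: less_imp_le)
  qed
  then show ?thesis by (auto simp: sorted_wrt_iff_nth_less)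
qed

text \<open>Letters never increase distances, so a distance that survives the whole word survives
  each letter, and \<open>letter_lincomb\<close> applies at every stage.\<close>

lemma word_lincomb:
  assumes I: "finite I" "\<And>i. i \<in> I \<Longrightarrow> c i \<ge> 0" "(\<Sum>i\<in>I. c i) = 1"
    and a: "\<And>i. i \<in> I \<Longrightarrow> length (a i) = m" "\<And>i. i \<in> I \<Longrightarrow> sorted (a i)"
      "\<And>i. i \<in> I \<Longrightarrow> residue_distinct m (a i)"
    and iso: "\<And>i j. i \<in> I \<Longrightarrow> j \<in> I \<Longrightarrow>
      sqdist (a i) (a j) \<le> sqdist (word_action m w (a i)) (word_action m w (a j))"
  shows "word_action m w (lincomb m I c a) = lincomb m I c (\<lambda>i. word_action m w (a i))
    \<and> tie_free m w (lincomb m I c a)"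
  using a iso
proof (induction w arbitrary: a)
  case Nil
  have "sorted_wrt (<) (lincomb m I c a)"
    by (rule strict_sorted_lincomb[OF I])
      (use Nil in \<open>auto simp: strict_sorted_iff intro: residue_distinct_imp_distinct\<close>)
  then show ?case by simp
next
  case (Cons l w)
  note prems = Cons.prems
  let ?b = "\<lambda>i. letter_action m l (a i)"
  have "sqdist (?b i) (?b j) \<le> sqdist (word_action m w (?b i)) (word_action m w (?b j))"
    if "i \<in> I" "j \<in> I" for i j
    using sqdist_letter_le[of "a i" m "a j" l] prems(1) prems(4)[OF that] that by simp
  note IH = Cons.IH[of ?b, OF _ _ _ this]
  have "letter_action m l (lincomb m I c a) = lincomb m I c ?b"
  proof (rule letter_lincomb[OF I prems(1,3)])
    fix i j assume ij: "i \<in> I" "j \<in> I"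
    show "sqdist (a i) (a j) \<le> sqdist (?b i) (?b j)"
      using prems(4)[OF ij] sqdist_word_le[of "?b i" m "?b j" w] by simp
  qed
  moreover have "sorted_wrt (<) (lincomb m I c a)"
    by (rule strict_sorted_lincomb[OF I])
      (use prems in \<open>auto simp: strict_sorted_iff intro: residue_distinct_imp_distinct\<close>)
  moreover have "sorted (?b i)" for i by (simp add: letter_action_raise)
  ultimately show ?case
    using IH prems by (simp add: residue_distinct_letter)
qed

lemma sqdist_funpow_le:
  assumes "length x = m" "length y = m"
  shows "sqdist ((word_action m w ^^ t) x) ((word_action m w ^^ t) y) \<le> sqdist x y"
  using assms
proof (induction t arbitrary: x y)
  case (Suc t)
  show ?case
    using Suc.IH[of "word_action m w x" "word_action m w y"] sqdist_word_le[OF Suc.prems, of w] Suc.prems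
    by (simp add: funpow_swap1 length_word_action)
qed simp

lemma exists_tie_free_fixed_point:
  assumes mn: "m > 0" "n > 0" and w: "w \<in> parking_words m n"
  obtains x where "x \<in> fixed_points m w" "tie_free m w x"
proof -
  define f where "f = word_action m w"
  from exists_periodic_point[OF assms] obtain y p where
    p: "p > 0" and y: "y \<in> V m" "residue_distinct m y" and per: "(f ^^ p) y = y"
    unfolding f_def .
  have ww: "w \<in> words m n" using w by (simp add: parking_words_def)
  define a where "a t = (f ^^ t) y" for t
  have a_Suc: "f (a t) = a (Suc t)" for t by (simp add: a_def)
  have aV: "a t \<in> V m \<and> residue_distinct m (a t)" for t
    by (induction t)
      (use y word_action_in_V[OF ww] residue_distinct_word V_D in \<open>auto simp: a_def f_def\<close>)
  then have aD: "length (a t) = m" "sorted (a t)" "sum_list (a t) = 0" "residue_distinct m (a t)" for t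
    using V_D[of "a t" m] by auto
  \<comment> \<open>After \<open>f\<close>, another \<open>p - 1\<close> applications close the
    cycle. As distances never grow on the way, \<open>f\<close> cannot shrink any distance within
    the orbit.\<close>
  have cyc: "(f ^^ (p - 1)) (f (a t)) = a t" for t
  proof -
    have "(f ^^ (p - 1)) (f (a t)) = (f ^^ (Suc (p - 1) + t)) y"
      by (simp add: a_def funpow_add funpow_swap1)
    also have "Suc (p - 1) + t = t + p" using p by simp
    also have "(f ^^ (t + p)) y = a t" by (simp add: funpow_add per a_def)
    finally show ?thesis .
  qed
  define x where "x = lincomb m {..<p} (\<lambda>_. 1 / real p) a"
  have "f x = lincomb m {..<p} (\<lambda>_. 1 / real p) (\<lambda>t. f (a t)) \<and> tie_free m w x"
    unfolding x_def f_def
  proof (rule word_lincomb)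
    fix i j
    show "sqdist (a i) (a j) \<le> sqdist (word_action m w (a i)) (word_action m w (a j))"
      using sqdist_funpow_le[of "f (a i)" m "f (a j)" "p - 1" w] cyc aD
      by (simp add: f_def[symmetric] a_Suc)
  qed (use p aD in auto)
  \<comment> \<open>Shifting time by one replaces \<open>a 0\<close> by \<open>a p\<close> in the
    sum, and these are equal.\<close>
  moreover have "lincomb m {..<p} (\<lambda>_. 1 / real p) (\<lambda>t. f (a t)) = x"
  proof (rule nth_equalityI)
    fix k assume "k < length (lincomb m {..<p} (\<lambda>_. 1 / real p) (\<lambda>t. f (a t)))"
    then have k: "k < m" by simp
    have "(\<Sum>t<Suc p. a t ! k) = (\<Sum>t<p. a t ! k) + a p ! k" by simp
    moreover have "(\<Sum>t<Suc p. a t ! k) = a 0 ! k + (\<Sum>t<p. a (Suc t) ! k)"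
      by (rule sum.lessThan_Suc_shift)
    moreover have "a p = a 0" by (simp add: a_def per)
    ultimately have "(\<Sum>t<p. a (Suc t) ! k) = (\<Sum>t<p. a t ! k)" by simp
    then show "lincomb m {..<p} (\<lambda>_. 1 / real p) (\<lambda>t. f (a t)) ! k = x ! k"
      using k by (simp add: x_def a_Suc sum_divide_distrib[symmetric])
  qed (simp add: x_def)
  ultimately have fx: "f x = x" "tie_free m w x" by auto
  have "sorted_wrt (<) x" using fx(2) by (cases w) auto
  then have "sorted x" by (simp add: strict_sorted_iff)
  moreover have "(\<Sum>k<m. x ! k) = 0"
  proof -
    have "(\<Sum>k<m. x ! k) = (\<Sum>t<p. \<Sum>k<m. 1 / real p * a t ! k)"
      unfolding x_def by (simp, subst sum.swap, simp)
    also have "\<dots> = 0"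
      using aV by (simp add: sum_divide_distrib[symmetric] V_def)
    finally show ?thesis .
  qed
  ultimately have "x \<in> fixed_points m w"
    using fx by (simp add: fixed_points_def V_def f_def) (simp add: x_def)
  with fx(2) that show ?thesis by blast
qed

subsection \<open>Uniqueness in the coprime case\<close>

definition covers_residue :: "nat \<Rightarrow> real list \<Rightarrow> real \<Rightarrow> bool" where
  "covers_residue m x z \<longleftrightarrow> (\<exists>y\<in>set x. [z = y] (rmod real m))"

lemma covers_residue_iff_nth:
  "covers_residue m x z \<longleftrightarrow> (\<exists>k<length x. [z = x ! k] (rmod real m))"
  unfolding covers_residue_def set_conv_nth by blast

text \<open>Modulo \<open>m\<close> the raised coordinate is indistinguishable from the others, so
  the residue set is merely translated, whichever letter acts.\<close>

lemma covers_residue_letter: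
  assumes "length x = m"
  shows "covers_residue m (letter_action m l x) z \<longleftrightarrow> covers_residue m x (z + 1)"
proof -
  have "[z = raise m l x ! k] (rmod real m) \<longleftrightarrow> [z + 1 = x ! k] (rmod real m)" if "k < m" for k
    using rcong_raise[OF that, of l x] rcong_add_right_cancel[of z 1 "x ! k - 1" "real m"]
    by (simp add: rcong_def del: nth_raise rcong_add_right_cancel)
  then have "covers_residue m (raise m l x) z \<longleftrightarrow> covers_residue m x (z + 1)"
    unfolding covers_residue_iff_nth using assms by (auto simp del: nth_raise)
  then show ?thesis by (simp add: covers_residue_def letter_action_raise)
qed

lemma covers_residue_word:
  assumes "length x = m"
  shows "covers_residue m (word_action m w x) z \<longleftrightarrow> covers_residue m x (z + real (length w))"
  using assms
  by (induction w arbitrary: x) (auto simp: covers_residue_letter add_ac)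

text \<open>For coprime \<open>m\<close> and \<open>n\<close> the residues of a fixed point are invariant under translation by
  \<open>1\<close>, so that they are \<open>x ! 0, x ! 0 + 1, \<dots>, x ! 0 + m - 1\<close>.\<close>

lemma fixed_point_residues:
  assumes m: "m > 0" and n: "n > 0" and w: "w \<in> words m n" and cop: "gcd m n = 1"
    and x: "x \<in> fixed_points m w"
  shows "residue_distinct m x" "\<And>k. k < m \<Longrightarrow> x ! k - x ! 0 \<in> \<int>"
proof -
  have len: "length x = m" using x V_D by (auto simp: fixed_points_def)
  have lw: "length w = n" using w by (simp add: words_def)
  have step: "covers_residue m x z \<longleftrightarrow> covers_residue m x (z + real n)" for z
    using covers_residue_word[OF len, of w z] x lw by (simp add: fixed_points_def)
  have steps: "covers_residue m x z \<Longrightarrow> covers_residue m x (z + real r * real n)" for z r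
  proof (induction r)
    case (Suc r)
    then show ?case using step[of "z + real r * real n"] by (simp add: algebra_simps)
  qed simp
  \<comment> \<open>The residue set of a fixed point is closed under adding \<open>n\<close>; adding
    \<open>n\<close> repeatedly, \<open>r\<close> times with \<open>r * n\<close> congruent to 1
    modulo \<open>m\<close>, amounts to adding 1.\<close>
  obtain r q where "n * r = m * q + gcd n m" using bezout_nat[of n m] n by auto
  then have rq: "n * r = m * q + 1" using cop by (simp add: gcd.commute)
  have one: "covers_residue m x (z + 1)" if "covers_residue m x z" for z
  proof -
    have "real r * real n = real m * real q + 1"
      using arg_cong[OF rq, of real] by (simp add: mult.commute)
    then have "[z + 1 = z + real r * real n] (rmod real m)"
      by (auto simp: rcong_altdef intro!: exI[of _ "int q"])
    moreover have "covers_residue m x (z + real r * real n)" using steps[OF that] .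
    ultimately show ?thesis by (simp add: covers_residue_def rcong_def)
  qed
  have "covers_residue m x (x ! 0 + real j)" for j
  proof (induction j)
    case 0
    show ?case unfolding covers_residue_iff_nth using len m by (intro exI[of _ 0]) simp
  next
    case (Suc j)
    then show ?case using one[of "x ! 0 + real j"] by (simp add: add_ac)
  qed
  then have "\<forall>j. \<exists>k<m. [x ! 0 + real j = x ! k] (rmod real m)"
    by (simp add: covers_residue_iff_nth len)
  \<comment> \<open>\<open>\<kappa> j\<close> is a coordinate with the residue of
    \<open>x ! 0 + j\<close>. The \<open>m\<close> incongruent values occupy \<open>m\<close>
    coordinates, so \<open>\<kappa>\<close> permutes the indices.\<close>
  then obtain \<kappa> where \<kappa>: "\<And>j. \<kappa> j < m" "\<And>j. [x ! 0 + real j = x ! \<kappa> j] (rmod real m)"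
    by metis
  have inj: "i = j" if "i < m" "j < m" "[x ! 0 + real i = x ! 0 + real j] (rmod real m)" for i j
  proof -
    have "[real i = real j] (rmod real m)" using that(3) by simp
    then have "real i = real j" by (rule rcong_imp_eq) (use that in auto)
    then show ?thesis by simp
  qed
  have "inj_on \<kappa> {..<m}"
  proof (rule inj_onI)
    fix i j assume ij: "i \<in> {..<m}" "j \<in> {..<m}" "\<kappa> i = \<kappa> j"
    have "[x ! 0 + real i = x ! 0 + real j] (rmod real m)"
      using \<kappa>(2)[of i] \<kappa>(2)[of j] unfolding ij(3) rcong_def by simp
    then show "i = j" using inj ij by blast
  qed
  moreover have "\<kappa> ` {..<m} \<subseteq> {..<m}" using \<kappa>(1) by (simp add: image_subset_iff)
  ultimately have "\<kappa> ` {..<m} = {..<m}" by (simp add: endo_inj_surj)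
  then have surj: "\<exists>j<m. k = \<kappa> j" if "k < m" for k
    using that by (metis imageE lessThan_iff)
  show "x ! k - x ! 0 \<in> \<int>" if k: "k < m" for k
  proof -
    obtain j where "k = \<kappa> j" using surj[OF k] by blast
    then obtain c where "x ! k = x ! 0 + real j + of_int c * real m"
      using \<kappa>(2)[of j] by (auto simp: rcong_altdef)
    then show ?thesis by simp
  qed
  have "k = k'" if k: "k < m" "k' < m" "[x ! k = x ! k'] (rmod real m)" for k k'
  proof -
    obtain j j' where j: "j < m" "k = \<kappa> j" "j' < m" "k' = \<kappa> j'"
      using surj[OF k(1)] surj[OF k(2)] by blast
    then have "[x ! 0 + real j = x ! 0 + real j'] (rmod real m)"
      using k(3) \<kappa>(2)[of j] \<kappa>(2)[of j'] by (simp only: rcong_def)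
    then show ?thesis using inj[OF j(1,3)] j by simp
  qed
  then show "residue_distinct m x"
    using len by (auto simp: residue_distinct_def distinct_conv_nth rcong_def)
qed

lemma fixed_point_unique:
  assumes m: "m > 0" and n: "n > 0" and w: "w \<in> words m n" and cop: "gcd m n = 1"
    and x: "x \<in> fixed_points m w" and y: "y \<in> fixed_points m w"
  shows "x = y"
proof -
  note fp = fixed_point_residues[OF m n w cop]
  have xV: "x \<in> V m" and yV: "y \<in> V m" and fx: "word_action m w x = x" and fy: "word_action m w y = y"
    using x y by (auto simp: fixed_points_def)
  have diff: "x ! k - x ! 0 = y ! k - y ! 0" if k: "k < m" for k
  proof -
    from fp(2)[OF x k] fp(2)[OF y k] obtain X Y where
      X: "x ! k - x ! 0 = of_int X" and Y: "y ! k - y ! 0 = of_int Y"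
      by (auto elim!: Ints_cases)
    \<comment> \<open>The point \<open>z\<close> below moves from \<open>x\<close> towards
      \<open>y\<close> by the fraction 1 / N. If \<open>z\<close> is fixed, its coordinate
      difference is an integer, so \<open>N\<close> divides \<open>Y - X\<close>; as
      \<open>N\<close> exceeds its absolute value, \<open>Y = X\<close>.\<close>
    define N :: real where "N = of_int (\<bar>Y - X\<bar> + 1)"
    have N: "N \<ge> 1" by (simp add: N_def)
    define c where "c b = (if b then 1 / N else 1 - 1 / N)" for b
    define a where "a b = (if b then y else x)" for b
    define z where "z = lincomb m UNIV c a"
    have z_nth: "z ! i = y ! i / N + (1 - 1 / N) * x ! i" if "i < m" for i
      using that by (simp add: z_def UNIV_bool c_def a_def)
    \<comment> \<open>Both points are fixed, so the word trivially preserves their distance.\<close>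
    have "word_action m w z = lincomb m UNIV c (\<lambda>b. word_action m w (a b)) \<and> tie_free m w z"
      unfolding z_def
      by (rule word_lincomb)
        (use N xV yV fx fy fp(1)[OF x] fp(1)[OF y] V_D[OF xV] V_D[OF yV] in
          \<open>auto simp: UNIV_bool c_def a_def\<close>)
    moreover have "lincomb m UNIV c (\<lambda>b. word_action m w (a b)) = z"
      unfolding z_def by (rule lincomb_cong) (simp add: a_def fx fy)
    ultimately have fz: "word_action m w z = z" "tie_free m w z" by auto
    have "sorted_wrt (<) z" using fz(2) by (cases w) auto
    moreover have "(\<Sum>i<m. z ! i) = 0"
      using xV yV by (simp add: z_nth sum.distrib sum_distrib_left[symmetric]
          sum_divide_distrib[symmetric] V_def)
    ultimately have "z \<in> fixed_points m w"
      using fz(1) by (simp add: fixed_points_def V_def strict_sorted_iff z_def)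
    from fp(2)[OF this k] obtain Z where Z: "z ! k - z ! 0 = of_int Z"
      by (auto elim!: Ints_cases)
    have "z ! k - z ! 0 = (y ! k - y ! 0) / N + (1 - 1 / N) * (x ! k - x ! 0)"
      using k m by (simp add: z_nth algebra_simps diff_divide_distrib)
    then have "of_int Z * N = real_of_int Y + (N - 1) * of_int X"
      unfolding X Y Z using N by (simp add: field_simps)
    then have "real_of_int ((Z - X) * (\<bar>Y - X\<bar> + 1)) = real_of_int (Y - X)"
      unfolding N_def by (simp add: algebra_simps)
    then have eq: "(Z - X) * (\<bar>Y - X\<bar> + 1) = Y - X" by (simp only: of_int_eq_iff)
    have "Y = X"
    proof (rule ccontr)
      assume "Y \<noteq> X"
      moreover have "\<bar>Y - X\<bar> + 1 dvd Y - X" using eq by (metis dvd_triv_right)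
      ultimately show False using dvd_imp_le_int[of "Y - X" "\<bar>Y - X\<bar> + 1"] by simp
    qed
    then show ?thesis using X Y by simp
  qed
  \<comment> \<open>The two points differ by a constant vector, and both have sum 0.\<close>
  have "(\<Sum>k<m. x ! k - y ! k) = (\<Sum>k<m. x ! 0 - y ! 0)"
    by (rule sum.cong) (use diff in \<open>auto simp: algebra_simps\<close>)
  moreover have "(\<Sum>k<m. x ! k - y ! k) = 0" using xV yV by (simp add: V_def sum_subtractf)
  ultimately have "x ! 0 = y ! 0" using m by simp
  then show "x = y"
    using diff V_D[OF xV] V_D[OF yV] by (intro nth_equalityI) force+
qed

subsection \<open>Perturbation in the non-coprime case\<close>

text \<open>In the absence of ties, a letter never makes an element pass another one of the same residue
  modulo \<open>m\<close>. So every element keeps both summands of its label; \<open>t\<close> counts the letters applied so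
  far and compensates for their subtractions of \<open>1\<close>.\<close>

definition label :: "nat \<Rightarrow> nat \<Rightarrow> nat \<Rightarrow> real list \<Rightarrow> real \<Rightarrow> real" where
  "label m d t x z = real (length (filter (\<lambda>y. y < z \<and> [y = z] (rmod real m)) x))
    + ((z + real t) rmod real d) / real d"

lemma length_filter_sort: "length (filter P (sort xs)) = length (filter P xs)"
  by (metis mset_filter mset_sort size_mset)

lemma label_letter:
  assumes m: "m > 0" and d: "d dvd m" and x: "length x = m" "distinct x"
    and dl: "distinct (letter_action m l x)" and k: "k < m"
  shows "label m d (Suc t) (letter_action m l x) (raise m l x ! k) = label m d t x (x ! k)"
proof -
  let ?r = "raise m l x"
  have dr: "distinct ?r" using dl by (simp add: letter_action_raise)
  have "(?r ! j < ?r ! k \<and> [?r ! j = ?r ! k] (rmod real m)) \<longleftrightarrow> (x ! j < x ! k \<and> [x ! j = x ! k] (rmod real m))"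
    if j: "j < m" for j
  proof (cases "j = k")
    case False
    have cong: "[?r ! j = ?r ! k] (rmod real m) \<longleftrightarrow> [x ! j = x ! k] (rmod real m)"
      using rcong_raise[OF j, of l x] rcong_raise[OF k, of l x]
        rcong_diff_right_cancel[of "x ! j" 1 "x ! k" "real m"]
      by (simp only: rcong_def)
    have "?r ! j < ?r ! k \<longleftrightarrow> x ! j < x ! k" if c: "[x ! j = x ! k] (rmod real m)"
    proof -
      obtain c where c: "x ! k = x ! j + of_int c * real m"
        using c by (auto simp: rcong_altdef)
      \<comment> \<open>The letter changes the multiple \<open>c\<close> by at most 1, and the
        absence of ties before and after excludes 0. So the multiple keeps its sign.\<close>
      define c' where "c' = c + (if k = l then 1 else 0) - (if j = l then 1 else 0)"
      have c': "?r ! k = ?r ! j + of_int c' * real m"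
        using c j k by (simp add: c'_def algebra_simps)
      have "x ! j \<noteq> x ! k" "?r ! j \<noteq> ?r ! k"
        using x dr j k False by (simp_all add: nth_eq_iff_index_eq del: nth_raise)
      then have "c \<noteq> 0" "c' \<noteq> 0" using c c' by auto
      then have "c > 0 \<longleftrightarrow> c' > 0" by (auto simp: c'_def split: if_splits)
      moreover have "x ! j < x ! k \<longleftrightarrow> c > 0" "?r ! j < ?r ! k \<longleftrightarrow> c' > 0"
        unfolding c c' using m by (simp_all add: zero_less_mult_iff)
      ultimately show ?thesis by simp
    qed
    then show ?thesis using cong by blast
  qed simp
  then have "length (filter (\<lambda>y. y < ?r ! k \<and> [y = ?r ! k] (rmod real m)) (letter_action m l x))
      = length (filter (\<lambda>y. y < x ! k \<and> [y = x ! k] (rmod real m)) x)"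
    unfolding letter_action_raise length_filter_sort unfolding length_filter_conv_card
    using x by (auto intro!: arg_cong[of _ _ card] simp del: nth_raise)
  \<comment> \<open>As \<open>d\<close> divides \<open>m\<close>, the added \<open>m\<close> is
    invisible modulo \<open>d\<close>, and \<open>Suc t\<close> offsets the subtracted 1.\<close>
  moreover have "(?r ! k + real (Suc t)) rmod real d = (x ! k + real t) rmod real d"
  proof -
    obtain e where e: "m = d * e" using d by blast
    have "[x ! k + real t = ?r ! k + real (Suc t)] (rmod real d)"
      unfolding rcong_altdef using k
      by (intro exI[of _ "if k = l then int e else 0"]) (simp add: e)
    then show ?thesis by (simp add: rcong_def)
  qed
  ultimately show ?thesis by (simp add: label_def)
qed

text \<open>A strict inequality survives small perturbations, equal arguments stay equal because
  \<open>L\<close> depends on the value only, and there are finitely many pairs.\<close>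

lemma eventually_perturbation_mono:
  fixes L :: "real \<Rightarrow> real"
  assumes "finite Z"
  shows "\<forall>\<^sub>F \<epsilon> in at_right 0. mono_on Z (\<lambda>z. z + \<epsilon> * L z)"
proof -
  have "\<forall>\<^sub>F \<epsilon> in at_right 0. z \<le> z' \<longrightarrow> z + \<epsilon> * L z \<le> z' + \<epsilon> * L z'" for z z'
  proof (cases "z < z'")
    case True
    have "((\<lambda>\<epsilon>. (z' + \<epsilon> * L z') - (z + \<epsilon> * L z)) \<longlongrightarrow> (z' + 0 * L z') - (z + 0 * L z)) (at_right 0)"
      by (intro tendsto_intros)
    then have "\<forall>\<^sub>F \<epsilon> in at_right 0. (z' + \<epsilon> * L z') - (z + \<epsilon> * L z) > 0"
      by (rule order_tendstoD) (use True in simp)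
    then show ?thesis by (rule eventually_mono) simp
  qed auto
  then have "\<forall>\<^sub>F \<epsilon> in at_right 0. \<forall>z\<in>Z. \<forall>z'\<in>Z. z \<le> z' \<longrightarrow> z + \<epsilon> * L z \<le> z' + \<epsilon> * L z'"
    by (intro eventually_ball_finite[OF assms] ballI)
  then show ?thesis by (rule eventually_mono) (auto simp: mono_on_def)
qed

definition perturb :: "nat \<Rightarrow> nat \<Rightarrow> nat \<Rightarrow> real \<Rightarrow> real list \<Rightarrow> real list" where
  "perturb m d t \<epsilon> x = map (\<lambda>z. z + \<epsilon> * label m d t x z) x"

text \<open>For small \<open>\<epsilon>\<close> the perturbation respects the order of the raised
  coordinates, so it commutes with sorting, while \<open>label_letter\<close> carries the labels
  along. Finitely many letters need finitely many thresholds.\<close>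

lemma eventually_word_perturb:
  assumes m: "m > 0" and d: "d dvd m" and x: "length x = m" "tie_free m w x"
  shows "\<forall>\<^sub>F \<epsilon> in at_right 0.
    word_action m w (perturb m d t \<epsilon> x) = perturb m d (t + length w) \<epsilon> (word_action m w x)"
  using x
proof (induction w arbitrary: x t)
  case (Cons l w)
  let ?y = "letter_action m l x"
  have dx: "distinct x" using Cons.prems by (simp add: strict_sorted_iff)
  have "sorted_wrt (<) ?y" using Cons.prems(2) by (cases w) auto
  then have dy: "distinct ?y" by (simp add: strict_sorted_iff)
  have "\<forall>\<^sub>F \<epsilon> in at_right 0. letter_action m l (perturb m d t \<epsilon> x) = perturb m d (Suc t) \<epsilon> ?y"
    using eventually_perturbation_mono[OF finite_set, of "raise m l x" "label m d (Suc t) ?y"]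
  proof (rule eventually_mono)
    fix \<epsilon> :: real
    let ?g = "\<lambda>z. z + \<epsilon> * label m d (Suc t) ?y z"
    assume mono: "mono_on (set (raise m l x)) ?g"
    have "raise m l (perturb m d t \<epsilon> x) = map ?g (raise m l x)"
    proof (rule nth_equalityI)
      fix k assume "k < length (raise m l (perturb m d t \<epsilon> x))"
      then have k: "k < m" by simp
      have "map ?g (raise m l x) ! k = ?g (raise m l x ! k)" using k by (intro nth_map) simp
      also have "\<dots> = raise m l x ! k + \<epsilon> * label m d t x (x ! k)"
        using label_letter[OF m d Cons.prems(1) dx dy k] by (simp only:)
      also have "\<dots> = raise m l (perturb m d t \<epsilon> x) ! k"
        using k Cons.prems(1) by (simp add: perturb_def)
      finally show "raise m l (perturb m d t \<epsilon> x) ! k = map ?g (raise m l x) ! k" ..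
    qed simp
    then show "letter_action m l (perturb m d t \<epsilon> x) = perturb m d (Suc t) \<epsilon> ?y"
      using sort_map_mono_on[OF mono] by (simp add: perturb_def letter_action_raise)
  qed
  moreover have "\<forall>\<^sub>F \<epsilon> in at_right 0. word_action m w (perturb m d (Suc t) \<epsilon> ?y)
      = perturb m d (Suc t + length w) \<epsilon> (word_action m w ?y)"
    by (rule Cons.IH) (use Cons.prems in auto)
  ultimately show ?case
    by eventually_elim simp
qed simp

text \<open>The minimum \<open>x ! 0\<close> has label below 1. Were the label constant, all rank
  parts would vanish, making the coordinates pairwise incongruent modulo \<open>m\<close>, and all
  would agree modulo \<open>d\<close>. But a class modulo \<open>d\<close> contains only m / d < m
  classes modulo \<open>m\<close>.\<close>

lemma label_not_constant:
  assumes d: "d > 1" "d dvd m" and m: "m > 0" and x: "length x = m" "sorted_wrt (<) x"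
  obtains k where "k < m" "label m d 0 x (x ! k) \<noteq> label m d 0 x (x ! 0)"
proof -
  have False if const: "\<And>k. k < m \<Longrightarrow> label m d 0 x (x ! k) = label m d 0 x (x ! 0)"
  proof -
    let ?F = "\<lambda>z. filter (\<lambda>y. y < z \<and> [y = z] (rmod real m)) x"
    have less: "x ! j < x ! k" if "j < k" "k < m" for j k
      using sorted_wrt_nth_less[OF x(2) that(1)] that x by simp
    have le0: "x ! 0 \<le> y" if y: "y \<in> set x" for y
    proof -
      obtain k where "k < m" "y = x ! k" using y x by (auto simp: in_set_conv_nth)
      then show ?thesis using less[of 0 k] by (cases "k = 0") auto
    qed
    then have "?F (x ! 0) = []" by (auto simp: filter_empty_conv not_less dest: leD)
    then have l0: "label m d 0 x (x ! 0) = (x ! 0 rmod real d) / real d"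
      by (simp add: label_def)
    moreover have "\<dots> < 1" using d rmod_less[of "real d" "x ! 0"] by simp
    ultimately have lt1: "label m d 0 x (x ! 0) < 1" by simp
    have F: "?F (x ! k) = []" and r: "[x ! 0 = x ! k] (rmod real d)" if k: "k < m" for k
    proof -
      have "(x ! k rmod real d) / real d \<ge> 0" using rmod_nonneg[of "real d" "x ! k"] d by simp
      moreover have "label m d 0 x (x ! k) = real (length (?F (x ! k))) + (x ! k rmod real d) / real d"
        by (simp add: label_def)
      ultimately have "real (length (?F (x ! k))) < 1"
        using const[OF k] lt1 by linarith
      then show F: "?F (x ! k) = []" by simp
      then show "[x ! 0 = x ! k] (rmod real d)"
        using const[OF k] d unfolding l0 by (simp add: label_def rcong_def)
    qed
    from r have "\<forall>k. \<exists>c. k < m \<longrightarrow> x ! k = x ! 0 + of_int c * real d"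
      by (auto simp: rcong_altdef)
    then obtain c where c: "\<And>k. k < m \<Longrightarrow> x ! k = x ! 0 + of_int (c k) * real d"
      by metis
    obtain e where e: "m = d * e" using d(2) by blast
    have "e > 0" "e < m" using e m d by auto
    \<comment> \<open>\<open>h\<close> numbers the \<open>e\<close> classes modulo \<open>m\<close>
      inside the class of \<open>x ! 0\<close> modulo \<open>d\<close>.\<close>
    define h where "h k = c k mod int e" for k
    have "h ` {..<m} \<subseteq> {0..<int e}" using \<open>e > 0\<close> by (auto simp: h_def)
    then have "card (h ` {..<m}) \<le> e"
      using card_mono[of "{0..<int e}" "h ` {..<m}"] by simp
    then have "\<not> inj_on h {..<m}"
      using \<open>e < m\<close> pigeonhole[of h "{..<m}"] by simp
    then obtain j k where "j < m" "k < m" "j \<noteq> k" "h j = h k"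
      by (auto simp: inj_on_def)
    then obtain j k where jk: "j < k" "k < m" "h j = h k"
      by (metis linorder_neqE_nat)
    from jk(3)[symmetric] have "int e dvd c k - c j" by (simp add: h_def mod_eq_dvd_iff)
    then obtain q where q: "c k - c j = int e * q" by blast
    have "x ! k - x ! j = of_int (c k - c j) * real d"
      using c[of j] c[of k] jk by (simp add: algebra_simps)
    then have "x ! k = x ! j + of_int q * real m"
      unfolding q by (simp add: e algebra_simps)
    then have "[x ! j = x ! k] (rmod real m)" by (auto simp: rcong_altdef)
    moreover have "x ! j \<in> set x" using jk x by simp
    ultimately show False using F[OF jk(2)] less[OF jk(1,2)] by (auto simp: filter_empty_conv)
  qed
  then show ?thesis using that by blast
qed

text \<open>Perturbing may destroy the zero sum; commuting with translations allows the mean to be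
  subtracted afterwards.\<close>

lemma letter_translate:
  assumes "length x = m"
  shows "letter_action m l (map (\<lambda>z. z + c) x) = map (\<lambda>z. z + c) (letter_action m l x)"
proof -
  have "raise m l (map (\<lambda>z. z + c) x) = map (\<lambda>z. z + c) (raise m l x)"
    by (rule nth_equalityI) (use assms in auto)
  then show ?thesis by (simp add: letter_action_raise sort_map_mono_on mono_on_def)
qed

lemma word_translate:
  assumes "length x = m"
  shows "word_action m w (map (\<lambda>z. z + c) x) = map (\<lambda>z. z + c) (word_action m w x)"
  using assms by (induction w arbitrary: x) (auto simp: letter_translate)

lemma infinite_fixed_points:
  assumes m: "m > 0" and w: "w \<in> words m n" and gcd: "gcd m n > 1"
    and x: "x \<in> fixed_points m w" "tie_free m w x"
  shows "infinite (fixed_points m w)"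
proof -
  define d where "d = gcd m n"
  have d: "d > 1" "d dvd m" "d dvd n" using gcd by (auto simp: d_def)
  have xV: "x \<in> V m" and fx: "word_action m w x = x" using x by (auto simp: fixed_points_def)
  note xD = V_D[OF xV]
  have sx: "sorted_wrt (<) x" using x(2) by (cases w) auto
  have lw: "length w = n" using w by (simp add: words_def)
  let ?L = "label m d 0 x" and ?p = "\<lambda>\<epsilon>. perturb m d 0 \<epsilon> x"
  obtain k where k: "k < m" "?L (x ! k) \<noteq> ?L (x ! 0)"
    using label_not_constant[OF d(1,2) m xD(1) sx] .
  \<comment> \<open>As \<open>d\<close> divides \<open>n\<close>, the time shift after the whole
    word leaves the labels unchanged.\<close>
  have "(z + real n) rmod real d = z rmod real d" for z
  proof -
    obtain e where "n = d * e" using d(3) by blast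
    then have "[z = z + real n] (rmod real d)"
      by (auto simp: rcong_altdef intro!: exI[of _ "int e"])
    then show ?thesis by (simp add: rcong_def)
  qed
  then have "label m d n x = ?L" by (simp add: label_def fun_eq_iff)
  then have pn: "perturb m d n \<epsilon> x = ?p \<epsilon>" for \<epsilon> by (simp add: perturb_def)
  have "\<forall>\<^sub>F \<epsilon> in at_right 0. word_action m w (?p \<epsilon>) = ?p \<epsilon>"
    using eventually_word_perturb[OF m d(2) xD(1) x(2), of 0] by (simp add: lw fx pn)
  moreover have "\<forall>\<^sub>F \<epsilon> in at_right 0. sorted (?p \<epsilon>)"
    using eventually_perturbation_mono[OF finite_set, of x ?L]
  proof (rule eventually_mono)
    fix \<epsilon> :: real assume "mono_on (set x) (\<lambda>z. z + \<epsilon> * ?L z)"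
    from sort_map_mono_on[OF this] have "sort (?p \<epsilon>) = ?p \<epsilon>"
      using xD(2) by (simp add: perturb_def sort_key_id_if_sorted)
    then show "sorted (?p \<epsilon>)" by (metis sorted_sort)
  qed
  ultimately have "\<forall>\<^sub>F \<epsilon> in at_right 0. word_action m w (?p \<epsilon>) = ?p \<epsilon> \<and> sorted (?p \<epsilon>)"
    by (rule eventually_conj)
  then obtain b where b: "b > 0"
    "\<And>\<epsilon>. 0 < \<epsilon> \<Longrightarrow> \<epsilon> < b \<Longrightarrow> word_action m w (?p \<epsilon>) = ?p \<epsilon> \<and> sorted (?p \<epsilon>)"
    by (auto simp: eventually_at_right[of 0 1, simplified])
  \<comment> \<open>Subtracting the mean brings the perturbed point back to
    \<open>V m\<close>.\<close>
  define c where "c \<epsilon> = - (\<Sum>i<m. ?p \<epsilon> ! i) / real m" for \<epsilon>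
  define q where "q \<epsilon> = map (\<lambda>z. z + c \<epsilon>) (?p \<epsilon>)" for \<epsilon>
  have lp: "length (?p \<epsilon>) = m" for \<epsilon> by (simp add: perturb_def xD)
  have "q \<epsilon> \<in> fixed_points m w" if e: "\<epsilon> \<in> {0<..<b}" for \<epsilon>
  proof -
    have p: "word_action m w (?p \<epsilon>) = ?p \<epsilon>" "sorted (?p \<epsilon>)" using b(2)[of \<epsilon>] e by auto
    have "word_action m w (q \<epsilon>) = q \<epsilon>"
      unfolding q_def word_translate[OF lp] p(1) ..
    moreover have "sorted (q \<epsilon>)"
      unfolding q_def sorted_map by (rule sorted_wrt_mono_rel[OF _ p(2)]) simp
    moreover have "(\<Sum>i<m. q \<epsilon> ! i) = 0"
      using m by (simp add: q_def lp c_def sum_subtractf)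
    ultimately show ?thesis by (simp add: fixed_points_def V_def q_def lp)
  qed
  then have "q ` {0<..<b} \<subseteq> fixed_points m w" by blast
  moreover have "inj_on q {0<..<b}"
  proof (rule inj_onI)
    fix \<epsilon> \<delta> assume "q \<epsilon> = q \<delta>"
    \<comment> \<open>Recentring cancels in a coordinate difference; the differing labels make it
      depend injectively on \<open>\<epsilon>\<close>.\<close>
    moreover have "q \<epsilon> ! k - q \<epsilon> ! 0 = x ! k - x ! 0 + \<epsilon> * (?L (x ! k) - ?L (x ! 0))" for \<epsilon>
      using k m xD(1) by (simp add: q_def lp) (simp add: perturb_def algebra_simps)
    ultimately have "\<epsilon> * (?L (x ! k) - ?L (x ! 0)) = \<delta> * (?L (x ! k) - ?L (x ! 0))"
      by (metis add_left_cancel)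
    then show "\<epsilon> = \<delta>" using k(2) by simp
  qed
  ultimately show ?thesis
    using b(1) by (meson finite_imageD finite_subset infinite_Ioo)
qed

section \<open>The four equivalences\<close>

theorem theorem1p1:
  fixes m n :: nat and w :: "nat list"
  assumes "m > 0" and "n > 0" and "w \<in> words m n"
  shows "((\<exists>x. x \<in> fixed_points m w) \<longleftrightarrow> w \<in> parking_words m n)
    \<and> ((\<exists>!x. x \<in> fixed_points m w) \<longleftrightarrow> w \<in> parking_words m n \<and> gcd m n = 1)
    \<and> (infinite (fixed_points m w) \<longleftrightarrow> w \<in> parking_words m n \<and> gcd m n > 1)
    \<and> (fixed_points m w = {} \<longleftrightarrow> w \<in> words m n - parking_words m n)"
proof -
  have ex: "(\<exists>x. x \<in> fixed_points m w) \<longleftrightarrow> w \<in> parking_words m n"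
  proof
    assume "w \<in> parking_words m n"
    then show "\<exists>x. x \<in> fixed_points m w"
      using exists_tie_free_fixed_point[OF assms(1,2)] by metis
  qed (use no_fixed_point_if_not_parking[OF assms(1,3)] in \<open>auto simp: fixed_points_def\<close>)
  have unique: "x = y" if "gcd m n = 1" "x \<in> fixed_points m w" "y \<in> fixed_points m w" for x y
    using fixed_point_unique[OF assms that] .
  have inf: "infinite (fixed_points m w)" if "w \<in> parking_words m n" "gcd m n > 1"
    using exists_tie_free_fixed_point[OF assms(1,2) that(1)]
      infinite_fixed_points[OF assms(1,3) that(2)] by metis
  have gcd: "gcd m n = 1 \<or> gcd m n > 1" using gcd_pos_nat[of m n] assms(1) by linarith
  have single: "finite (fixed_points m w)" if "gcd m n = 1"
  proof (cases "fixed_points m w = {}")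
    case False
    then obtain x where "x \<in> fixed_points m w" by blast
    then have "fixed_points m w \<subseteq> {x}" using unique[OF that] by blast
    then show ?thesis by (rule finite_subset) simp
  qed simp
  have not_single: "\<not> (\<exists>!x. x \<in> fixed_points m w)" if "infinite (fixed_points m w)"
  proof
    assume "\<exists>!x. x \<in> fixed_points m w"
    then obtain x where "fixed_points m w = {x}" by blast
    then show False using that by simp
  qed
  have "(\<exists>!x. x \<in> fixed_points m w) \<longleftrightarrow> w \<in> parking_words m n \<and> gcd m n = 1"
  proof
    assume e: "\<exists>!x. x \<in> fixed_points m w"
    then have "\<exists>x. x \<in> fixed_points m w" by blast
    then have "w \<in> parking_words m n" using ex by blast
    moreover from this have "\<not> gcd m n > 1" using inf not_single e by blast
    ultimately show "w \<in> parking_words m n \<and> gcd m n = 1" using gcd by blast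
  next
    assume w: "w \<in> parking_words m n \<and> gcd m n = 1"
    then obtain x where "x \<in> fixed_points m w" using ex by blast
    then show "\<exists>!x. x \<in> fixed_points m w"
      by (intro ex1I[of _ x] unique) (use w in auto)
  qed
  moreover have "infinite (fixed_points m w) \<longleftrightarrow> w \<in> parking_words m n \<and> gcd m n > 1"
  proof
    assume i: "infinite (fixed_points m w)"
    then have "fixed_points m w \<noteq> {}" by auto
    then show "w \<in> parking_words m n \<and> gcd m n > 1" using ex single gcd i by blast
  qed (use inf in blast)
  moreover have "fixed_points m w = {} \<longleftrightarrow> w \<in> words m n - parking_words m n"
    using ex assms(3) by blast
  ultimately show ?thesis using ex by blast
qed

end
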